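(* Let $p, q \in \mathbb{N}$ with $p < q$. For each $n \in \mathbb{N}$, define $a_n := |M_{p,q,n+q}|$. Then for every $n \in \mathbb{N}$, $$a_{n+2q+2} \ =\ 2a_{n+2q+1} - a_{n+2q} + 2a_{n+q+1} - 2a_{n+q} - a_n.$$
   Context: $\mathbb{N} = \{1,2,3,\dots\}$. For a finite nonempty set $S \subseteq \mathbb{N}$, $|S|$ denotes its cardinality and $\min_2 S$ denotes its second smallest element if $|S| \ge 2$; if $|S| = 1$, then $\min_2 S$ is by convention the unique element of $S$ (so $\min_2 S = \min S$). For $p, q, n \in \mathbb{N}$, define $$M_{p,q,n} := \{S \subseteq \mathbb{N} : S \text{ is finite and nonempty},\ \max S = n,\ \min S \ge p|S|,\ \textstyle\min_2 S \ge q|S|\}.$$ *)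

theory Defs
  imports Main
begin

text \<open>
  The positive integers are rendered as the type nat together with explicit positivity
  conditions: the sets counted are subsets of \<open>{1..}\<close>.
\<close>

definition min2 :: "nat set \<Rightarrow> nat" where
  "min2 S = (if card S \<ge> 2 then Min (S - {Min S}) else Min S)"

definition M :: "nat \<Rightarrow> nat \<Rightarrow> nat \<Rightarrow> nat set set" where
  "M p q n = {S. S \<subseteq> {1..} \<and> finite S \<and> S \<noteq> {} \<and> Max S = n \<and>
                 Min S \<ge> p * card S \<and> min2 S \<ge> q * card S}"

text \<open>The cardinality below is never the default value for infinite sets.\<close>

lemma finite_M: "finite (M p q n)"
  by (rule finite_subset[of _ "Pow {..n}"]) (auto simp: M_def)

definition a :: "nat \<Rightarrow> nat \<Rightarrow> nat \<Rightarrow> nat" where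
  "a p q n = card (M p q (n + q))"

end

theory Submission
  imports Defs
begin

text \<open>
  Sort the sets \<open>S\<close> counted by \<open>a p q n\<close> by their size \<open>j + 1\<close>.  Their maximum is \<open>n + q\<close>, so
  the interval from \<open>q * (j + 1)\<close> up to just below the maximum has \<open>n - q * j\<close> elements.  Either
  all of \<open>S\<close> lies above the threshold \<open>q * (j + 1)\<close>, which leaves \<open>(n - q * j) choose j\<close>
  possibilities, or only the minimum lies below it; then the minimum can be chosen freely among
  \<open>(q - p) * (j + 1)\<close> values, and what remains is a \<open>j\<close>-subset of the interval including the
  maximum.  Hence
  \[ a_n = (q - p)\,(V_{n+1} - V_n) + F_n, \qquad
     F_n = \sum_j {n - qj \choose j}, \qquad V_n = \sum_j (j + 1) {n - qj \choose j}. \]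

  Let \<open>L\<close> be the difference operator taking \<open>b\<close> to \<open>\<lambda>n. b (n + q + 1) - b (n + q) - b n\<close>.
  Pascal's rule says that \<open>L\<close> annihilates \<open>F\<close> and, because the weight \<open>j + 1\<close> grows by one when
  \<open>j\<close> does, that \<open>L\<close> sends \<open>V\<close> to \<open>F\<close>.  Since \<open>L\<close> commutes with shifts, \<open>L (L a) = 0\<close>, and
  this is the claimed recurrence written out.
\<close>

section \<open>Weighted sums along lines in Pascal's triangle\<close>

text \<open>
  The truncated subtraction is harmless: when \<open>q * i > m\<close>, the index \<open>i\<close> is positive and the
  binomial coefficient is \<open>0 choose i = 0\<close>.
\<close>

definition diag_sum :: "nat \<Rightarrow> (nat \<Rightarrow> int) \<Rightarrow> nat \<Rightarrow> int" where
  "diag_sum q w m = (\<Sum>i\<le>m. w i * int ((m - q * i) choose i))"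

lemma diag_sum_extend:
  assumes "m \<le> K"
  shows "diag_sum q w m = (\<Sum>i\<le>K. w i * int ((m - q * i) choose i))"
  unfolding diag_sum_def
  by (rule sum.mono_neutral_left) (use assms in \<open>auto simp: binomial_eq_0\<close>)

text \<open>
  Pascal's rule applied to each summand; the summands with \<open>q * i > m\<close> vanish on both sides.
\<close>

lemma diag_sum_rec:
  "diag_sum q w (m + q + 1) = diag_sum q w (m + q) + diag_sum q (\<lambda>i. w (Suc i)) m"
proof -
  have pascal: "(m + q + 1 - q * Suc i) choose Suc i
      = ((m + q - q * Suc i) choose Suc i) + ((m - q * i) choose i)" for i
  proof (cases "q * i \<le> m")
    case True
    then have "m + q + 1 - q * Suc i = Suc (m - q * i)" "m + q - q * Suc i = m - q * i"
      by (simp_all add: Suc_diff_le)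
    then show ?thesis by simp
  next
    case False
    then have "i > 0" by (cases i) auto
    with False show ?thesis by simp
  qed
  have split: "diag_sum q w M' = w 0 + (\<Sum>i\<le>m + q. w (Suc i) * int ((M' - q * Suc i) choose Suc i))"
    if "M' \<le> m + q + 1" for M'
    using diag_sum_extend[of M' "Suc (m + q)" q w] that
    unfolding sum.atMost_Suc_shift by simp
  have "diag_sum q w (m + q + 1)
      = diag_sum q w (m + q) + (\<Sum>i\<le>m + q. w (Suc i) * int ((m - q * i) choose i))"
    unfolding split[OF order_refl] split[of "m + q", simplified] pascal
    by (simp add: sum.distrib distrib_left)
  then show ?thesis
    using diag_sum_extend[of m "m + q" q "\<lambda>i. w (Suc i)"] by simp
qed

lemma diag_sum_add: "diag_sum q (\<lambda>i. v i + w i) m = diag_sum q v m + diag_sum q w m"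
  by (simp add: diag_sum_def sum.distrib distrib_right)

section \<open>Counting the sets of a given size\<close>

lemma card_subsets_with_max:
  fixes b N k :: nat
  shows "card {T. T \<subseteq> {b..N} \<and> N \<in> T \<and> card T = k} + ((N - b) choose k)
    = (Suc N - b) choose k"
proof -
  let ?X = "{T. T \<subseteq> {b..N} \<and> N \<in> T \<and> card T = k}"
  let ?Y = "{T. T \<subseteq> {b..<N} \<and> card T = k}"
  have "{T. T \<subseteq> {b..N} \<and> card T = k} = ?X \<union> ?Y"
    by (force simp: subset_iff order_le_less)
  moreover have "finite ?X" "finite ?Y"
    by (auto intro: finite_subset[of _ "Pow {b..N}"])
  moreover have "?X \<inter> ?Y = {}" by auto
  ultimately have "card {T. T \<subseteq> {b..N} \<and> card T = k} = card ?X + card ?Y"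
    by (simp add: card_Un_disjoint)
  then show ?thesis
    using n_subsets[of "{b..N}" k] n_subsets[of "{b..<N}" k] by simp
qed

text \<open>
  Once the minimum reaches the bound for \<open>min2\<close>, both conditions of \<open>M\<close> hold, so \<open>N\<close> is forced and
  the other \<open>j\<close> elements are arbitrary between the threshold and \<open>N\<close>.
\<close>

lemma card_M_above_threshold:
  assumes "p < q" "N \<ge> q"
  shows "card {S \<in> M p q N. card S = Suc j \<and> Min S \<ge> q * Suc j} = (N - q * Suc j) choose j"
proof -
  let ?b = "q * Suc j"
  have "?b \<ge> 1" using assms by simp
  have "{S \<in> M p q N. card S = Suc j \<and> Min S \<ge> ?b}
      = {T. T \<subseteq> {?b..N} \<and> N \<in> T \<and> card T = Suc j}" (is "?L = ?R")
  proof (intro set_eqI iffI)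
    fix S assume S: "S \<in> ?L"
    then have fin: "finite S" and ne: "S \<noteq> {}" and Max: "Max S = N" by (auto simp: M_def)
    have "N \<in> S" using Max_in[OF fin ne] Max by simp
    moreover have "S \<subseteq> {Min S..Max S}" using fin by auto
    ultimately show "S \<in> ?R" using S Max by auto
  next
    fix S assume S: "S \<in> ?R"
    then have fin: "finite S" and ne: "S \<noteq> {}" by (auto intro: finite_subset)
    have "Max S = N" using S fin by (intro Max_eqI) auto
    moreover have Min: "Min S \<ge> ?b" using S fin ne by auto
    moreover have "p * Suc j \<le> ?b" using assms by (intro mult_le_mono1) simp
    moreover have "min2 S \<ge> ?b"
    proof (cases "card S \<ge> 2")
      case True
      then have "S - {Min S} \<noteq> {}" using fin ne
        by (metis One_nat_def Suc_1 Suc_n_not_le_n card.empty card_Suc_Diff1 Min_in)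
      then show ?thesis using S True fin by (auto simp: min2_def)
    qed (use Min in \<open>simp add: min2_def\<close>)
    ultimately show "S \<in> ?L"
      using S fin ne \<open>?b \<ge> 1\<close> by (auto simp: M_def)
  qed
  then have "card ?L + ((N - ?b) choose Suc j) = (Suc N - ?b) choose Suc j"
    using card_subsets_with_max[of ?b N "Suc j"] by simp
  moreover have "(Suc N - ?b) choose Suc j = ((N - ?b) choose j) + ((N - ?b) choose Suc j)"
  proof (cases "?b \<le> N")
    case True
    then show ?thesis by (simp only: Suc_diff_le binomial_Suc_Suc)
  next
    case False
    \<comment> \<open>Here \<open>j\<close> is positive: for \<open>j = 0\<close> the threshold is \<open>q\<close>, which is at most \<open>N\<close>.\<close>
    with assms show ?thesis by (cases j) auto
  qed
  ultimately show ?thesis by simp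
qed

text \<open>
  Such a set is determined by its minimum, the only element below the threshold, and by the rest.
  For \<open>j = 0\<close> both sides are zero, a set with one element having equal \<open>Min\<close> and \<open>min2\<close>.
\<close>

lemma card_M_below_threshold:
  assumes "p \<ge> 1" "p < q"
  shows "card {S \<in> M p q N. card S = Suc j \<and> Min S < q * Suc j}
    = (q - p) * Suc j * card {T. T \<subseteq> {q * Suc j..N} \<and> N \<in> T \<and> card T = j}"
proof -
  let ?b = "q * Suc j"
  let ?X = "{T. T \<subseteq> {?b..N} \<and> N \<in> T \<and> card T = j}"
  let ?D = "{p * Suc j..<?b} \<times> ?X"
  let ?f = "\<lambda>(m, T). insert m T"
  have inj: "inj_on ?f ?D"
  proof (rule inj_onI)
    fix x y assume "x \<in> ?D" "y \<in> ?D" "?f x = ?f y"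
    moreover obtain m T m' T' where xy: "x = (m, T)" "y = (m', T')" by (cases x, cases y)
    ultimately have *: "m < ?b" "m' < ?b" "T \<subseteq> {?b..N}" "T' \<subseteq> {?b..N}"
      and eq: "insert m T = insert m' T'"
      by auto
    have "insert m T \<inter> {..<?b} = {m}" "insert m' T' \<inter> {..<?b} = {m'}"
      and "insert m T \<inter> {?b..} = T" "insert m' T' \<inter> {?b..} = T'"
      using * by auto
    then have "{m} = {m'}" "T = T'" unfolding eq by simp_all
    then show "x = y" using xy by simp
  qed
  have "{S \<in> M p q N. card S = Suc j \<and> Min S < ?b} = ?f ` ?D" (is "?L = _")
  proof (intro set_eqI iffI)
    fix S assume "S \<in> ?L"
    then have S: "S \<in> M p q N" and card: "card S = Suc j" and Min_less: "Min S < ?b"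
      by blast+
    from S have fin: "finite S" and ne: "S \<noteq> {}" and Max: "Max S = N"
      and "p * card S \<le> Min S" and "q * card S \<le> min2 S"
      unfolding M_def by blast+
    with card Min_less have Min: "p * Suc j \<le> Min S" "Min S < ?b" and min2: "?b \<le> min2 S"
      by metis+
    let ?T = "S - {Min S}"
    have two: "card S \<ge> 2" using Min min2 by (auto simp: min2_def split: if_splits)
    have "Min ?T \<ge> ?b" using min2 two by (simp add: min2_def)
    moreover have cardT: "card ?T = j" using fin ne card by simp
    moreover have "?T \<noteq> {}"
      using two card cardT by (metis card.empty Suc_1 Suc_n_not_le_n One_nat_def)
    ultimately have ge: "\<forall>x\<in>?T. ?b \<le> x" using fin by simp
    have le: "\<forall>x\<in>S. x \<le> N" using fin Max by auto
    obtain t where "t \<in> ?T" using \<open>?T \<noteq> {}\<close> by blast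
    with ge le have "?b \<le> N" by (meson DiffD1 order_trans)
    then have "N \<in> ?T" using Max_in[OF fin ne] Max Min by auto
    moreover have "S = insert (Min S) ?T" using Min_in[OF fin ne] by blast
    ultimately show "S \<in> ?f ` ?D"
      using Min ge le cardT by (intro image_eqI[of _ _ "(Min S, ?T)"]) auto
  next
    fix S assume "S \<in> ?f ` ?D"
    then obtain m T where S: "S = insert m T" and m: "p * Suc j \<le> m" "m < ?b"
      and T: "T \<subseteq> {?b..N}" "N \<in> T" "card T = j"
      by auto
    have fin: "finite T" using T by (auto intro: finite_subset)
    have "m \<notin> T" using m T by auto
    then have cardS: "card S = Suc j" using S T fin by simp
    have "?b \<le> N" using T by auto
    have Min: "Min S = m" unfolding S using fin m T by (intro Min_eqI) auto
    have "Max S = N" unfolding S using fin m T \<open>?b \<le> N\<close> by (intro Max_eqI) auto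
    have "card S \<ge> 2" using cardS T fin by (cases j) auto
    then have "min2 S = Min T"
      using Min \<open>m \<notin> T\<close> by (simp add: min2_def S)
    also have "Min T \<ge> ?b" using T fin by (subst Min_ge_iff) auto
    finally have "min2 S \<ge> ?b" .
    moreover have "S \<subseteq> {1..}"
    proof -
      have "p * Suc j \<ge> 1" using assms by simp
      with S m T show ?thesis by force
    qed
    ultimately show "S \<in> ?L"
      using S cardS fin m Min \<open>Max S = N\<close> by (simp add: M_def)
  qed
  then have "card ?L = card ?D" using card_image[OF inj] by simp
  also have "\<dots> = (q - p) * Suc j * card ?X"
    by (simp only: card_cartesian_product card_atLeastLessThan diff_mult_distrib)
  finally show ?thesis .
qed

text \<open>
  Writing the number of \<open>j\<close>-sets containing the maximum as a difference of two binomial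
  coefficients, rather than as one with lower index \<open>j - 1\<close>, keeps the formula valid for \<open>j = 0\<close>
  and for \<open>q * j > n\<close>, and turns its sum over \<open>j\<close> into a difference of consecutive values of
  \<^const>\<open>diag_sum\<close>.
\<close>

lemma card_M_of_size:
  assumes "p \<ge> 1" "p < q"
  shows "int (card {S \<in> M p q (n + q). card S = Suc j})
    = int (q - p) * (int (Suc j) * int ((n + 1 - q * j) choose j)
        - int (Suc j) * int ((n - q * j) choose j))
      + int ((n - q * j) choose j)"
proof -
  let ?b = "q * Suc j"
  let ?A = "{S \<in> M p q (n + q). card S = Suc j \<and> Min S \<ge> ?b}"
  let ?B = "{S \<in> M p q (n + q). card S = Suc j \<and> Min S < ?b}"
  let ?X = "{T. T \<subseteq> {?b..n + q} \<and> n + q \<in> T \<and> card T = j}"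
  have "{S \<in> M p q (n + q). card S = Suc j} = ?A \<union> ?B" by auto
  moreover have "finite ?A" "finite ?B" using finite_M by simp_all
  moreover have "?A \<inter> ?B = {}" by auto
  ultimately have "card {S \<in> M p q (n + q). card S = Suc j} = card ?A + card ?B"
    by (simp add: card_Un_disjoint)
  moreover have "card ?A = (n - q * j) choose j"
    using card_M_above_threshold[of p q "n + q" j] assms by simp
  moreover have "card ?B = (q - p) * Suc j * card ?X"
    using card_M_below_threshold[of p q "n + q" j] assms by simp
  moreover have "int (card ?X) = int ((n + 1 - q * j) choose j) - int ((n - q * j) choose j)"
    using card_subsets_with_max[of ?b "n + q" j] by simp
  ultimately show ?thesis
    by (simp only: of_nat_add of_nat_mult) (simp only: algebra_simps)
qed

lemma card_le_if_in_M:
  assumes "S \<in> M p q (n + q)" "q \<ge> 1"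
  shows "card S \<le> Suc n"
proof -
  have fin: "finite S" and ne: "S \<noteq> {}" and "Max S = n + q" and "q * card S \<le> min2 S"
    using assms by (auto simp: M_def)
  moreover have "min2 S \<in> S"
  proof (cases "card S \<ge> 2")
    case True
    then have "card (S - {Min S}) \<noteq> 0" using fin ne by simp
    then have "S - {Min S} \<noteq> {}" by (metis card.empty)
    with Min_in[of "S - {Min S}"] fin True show ?thesis by (simp add: min2_def)
  qed (use fin ne in \<open>simp add: min2_def\<close>)
  ultimately have "q * card S \<le> n + q" by (metis Max_ge order_trans)
  then have "q * (card S - 1) \<le> n" by (simp add: diff_mult_distrib2)
  then have "card S - 1 \<le> n"
    using assms(2) by (metis le_trans mult_le_mono1 nat_mult_1)
  then show ?thesis by simp
qed

theorem a_eq_diag_sum: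
  assumes "p \<ge> 1" "p < q"
  defines "V \<equiv> diag_sum q (\<lambda>j. int (Suc j))"
  shows "int (a p q n) = int (q - p) * (V (n + 1) - V n) + diag_sum q (\<lambda>_. 1) n"
proof -
  let ?P = "\<lambda>j. {S \<in> M p q (n + q). card S = Suc j}"
  have "M p q (n + q) = (\<Union>j\<le>n. ?P j)"
  proof -
    have "\<exists>j\<le>n. card S = Suc j" if "S \<in> M p q (n + q)" for S
    proof -
      have "card S \<noteq> 0" using that by (auto simp: M_def)
      then show ?thesis
        using card_le_if_in_M[OF that] assms by (cases "card S") auto
    qed
    then show ?thesis by auto
  qed
  moreover have "card (\<Union>j\<le>n. ?P j) = (\<Sum>j\<le>n. card (?P j))"
    by (rule card_UN_disjoint) (auto simp: finite_M)
  ultimately have "int (a p q n) = (\<Sum>j\<le>n. int (card (?P j)))"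
    by (simp add: a_def)
  also have "\<dots> = int (q - p) * ((\<Sum>j\<le>n. int (Suc j) * int ((n + 1 - q * j) choose j)) - V n)
      + diag_sum q (\<lambda>_. 1) n"
    unfolding card_M_of_size[OF assms(1,2)] V_def diag_sum_def
    by (simp only: sum.distrib sum_subtractf sum_distrib_left[symmetric] mult_1)
  also have "(\<Sum>j\<le>n. int (Suc j) * int ((n + 1 - q * j) choose j)) = V (n + 1)"
  proof -
    \<comment> \<open>The sum defining \<open>V (n + 1)\<close> has one more term, which is zero because \<open>q\<close> is positive.\<close>
    have "n + 1 - q * (n + 1) = 0" using mult_le_mono1[of 1 q "n + 1"] assms(2) by simp
    then have "((n + 1 - q * (n + 1)) choose (n + 1)) = 0"
      by (simp only: binomial_0_Suc Suc_eq_plus1[symmetric])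
    then show ?thesis by (simp add: V_def diag_sum_def)
  qed
  finally show ?thesis .
qed

section \<open>The recurrence\<close>

theorem corollary1p4:
  fixes p q n :: nat
  assumes "p \<ge> 1" and "q \<ge> 1" and "p < q" and "n \<ge> 1"
  shows "int (a p q (n + 2 * q + 2)) =
           2 * int (a p q (n + 2 * q + 1)) - int (a p q (n + 2 * q))
           + 2 * int (a p q (n + q + 1)) - 2 * int (a p q (n + q)) - int (a p q n)"
proof -
  let ?F = "diag_sum q (\<lambda>_. 1)"
  let ?V = "diag_sum q (\<lambda>j. int (Suc j))"
  let ?La = "\<lambda>m. int (a p q (m + q + 1)) - int (a p q (m + q)) - int (a p q m)"
  have F: "?F (m + q + 1) = ?F (m + q) + ?F m" for m
    by (rule diag_sum_rec)
  have V: "?V (m + q + 1) = ?V (m + q) + ?V m + ?F m" for m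
    using diag_sum_rec[of q "\<lambda>j. int (Suc j)" m] diag_sum_add[of q "\<lambda>j. int (Suc j)" "\<lambda>_. 1" m]
    by (simp add: add.commute)
  have La: "?La m = int (q - p) * (?F (m + 1) - ?F m)" for m
  proof -
    have "?La m = int (q - p) * ((?V (m + 1 + q + 1) - ?V (m + 1 + q) - ?V (m + 1))
        - (?V (m + q + 1) - ?V (m + q) - ?V m)) + (?F (m + q + 1) - ?F (m + q) - ?F m)"
      unfolding a_eq_diag_sum[OF assms(1,3)] by (simp add: algebra_simps)
    also have "\<dots> = int (q - p) * (?F (m + 1) - ?F m)"
      unfolding F V by simp
    finally show ?thesis .
  qed
  have "?La (n + q + 1) - ?La (n + q) - ?La n
      = int (q - p) * ((?F (n + 1 + q + 1) - ?F (n + 1 + q) - ?F (n + 1))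
          - (?F (n + q + 1) - ?F (n + q) - ?F n))"
    unfolding La by (simp add: algebra_simps)
  also have "\<dots> = 0" unfolding F by simp
  finally have "?La (n + q + 1) - ?La (n + q) - ?La n = 0" .
  moreover have "n + q + 1 + q + 1 = n + 2 * q + 2" "n + q + 1 + q = n + 2 * q + 1"
    "n + q + q + 1 = n + 2 * q + 1" "n + q + q = n + 2 * q"
    by simp_all
  ultimately show ?thesis by (simp only:)
qed

end
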